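(* Let $a>b$, $0<k<1$, $k'=\sqrt{1-k^2}$. For $s_1\in[0,2\mathsf K(k)]$, $s_2\in[0,\mathsf K(k))$ put $$x(s_1,s_2)=\frac{f_1(s_1)f_2(s_2)}{\sqrt{a-b}},\qquad y(s_1,s_2)=\frac{g_1(s_1)g_2(s_2)}{\sqrt{a-b}},$$ where $$f_1(s_1)=\sqrt{a-b}\,\operatorname{sn}(s_1,k),\quad g_1(s_1)=\sqrt{a-b}\,\operatorname{cn}(s_1,k),\quad f_2(s_2)=\frac{\sqrt{a-b}}{k}\,\frac{\operatorname{dn}(s_2,k)}{\operatorname{cn}(s_2,k)},\quad g_2(s_2)=\frac{k'\sqrt{a-b}}{k}\,\frac1{\operatorname{cn}(s_2,k)}.$$ Then for every constant $\xi$ the points $(x,y)$ with $s_1+s_2=\xi$ lie on a straight line, and for every constant $\eta$ the points $(x,y)$ with $s_2-s_1=\eta$ lie on a straight line. Moreover, all these lines are tangent to the ellipse $$\mathcal E_0:\quad\frac{x^2}{a_0}+\frac{y^2}{b_0}=1,\qquad a_0=\frac1{k^2}(a-b),\quad b_0=\frac{(k')^2}{k^2}(a-b),$$ and this ellipse belongs to the confocal family $\dfrac{x^2}{a+\lambda}+\dfrac{y^2}{b+\lambda}=1$, $\lambda\in\mathbb R$.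
   Context: $\operatorname{sn},\operatorname{cn},\operatorname{dn}$ are the Jacobi elliptic functions with modulus $k$, and $\mathsf K(k)$ is the complete elliptic integral of the first kind (the quarter-period of $\operatorname{sn}(\cdot,k)$). *)

theory Defs
  imports "HOL-Analysis.Analysis"
begin

text \<open>
  Real Jacobi elliptic functions with modulus \<open>k\<close> (not parameter \<open>m = k^2\<close>), for \<open>0 < k < 1\<close>.
  The interval integral is signed, so the incomplete integral \<open>ellF \<phi> k\<close> is an odd, strictly
  increasing bijection of the reals in \<open>\<phi>\<close>, and the amplitude is its inverse.
\<close>

definition ellF :: "real \<Rightarrow> real \<Rightarrow> real" where
  "ellF \<phi> k = (LBINT \<theta>=ereal 0..ereal \<phi>. 1 / sqrt (1 - k\<^sup>2 * (sin \<theta>)\<^sup>2))"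

definition ellK :: "real \<Rightarrow> real" where
  "ellK k = ellF (pi / 2) k"

definition jacobi_am :: "real \<Rightarrow> real \<Rightarrow> real" where
  "jacobi_am u k = (THE \<phi>. ellF \<phi> k = u)"

definition jacobi_sn :: "real \<Rightarrow> real \<Rightarrow> real" where
  "jacobi_sn u k = sin (jacobi_am u k)"

definition jacobi_cn :: "real \<Rightarrow> real \<Rightarrow> real" where
  "jacobi_cn u k = cos (jacobi_am u k)"

definition jacobi_dn :: "real \<Rightarrow> real \<Rightarrow> real" where
  "jacobi_dn u k = sqrt (1 - k\<^sup>2 * (jacobi_sn u k)\<^sup>2)"

text \<open>Meaningful only for nonzero \<open>\<alpha>\<close>, \<open>\<beta>\<close>, since division by zero yields zero.\<close>

definition central_conic :: "real \<Rightarrow> real \<Rightarrow> (real \<times> real) set" where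
  "central_conic \<alpha> \<beta> = {(x, y). x\<^sup>2 / \<alpha> + y\<^sup>2 / \<beta> = 1}"

text \<open>The members of the family with \<open>\<lambda> = - a\<close> or \<open>\<lambda> = - b\<close>, where the equation has no meaning,
  are excluded.\<close>

definition confocal_family :: "real \<Rightarrow> real \<Rightarrow> (real \<times> real) set set" where
  "confocal_family a b = {central_conic (a + l) (b + l) |l. a + l \<noteq> 0 \<and> b + l \<noteq> 0}"

definition straight_line :: "(real \<times> real) set \<Rightarrow> bool" where
  "straight_line L \<longleftrightarrow> affine L \<and> aff_dim L = 1"

text \<open>\<open>L\<close> passes through a point of \<open>C\<close> in the direction of the (nonzero) velocity there of a
  path running in \<open>C\<close>. For a smooth curve without singular points, such as an ellipse, these are
  exactly the tangent lines.\<close>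

definition tangent_to :: "(real \<times> real) set \<Rightarrow> (real \<times> real) set \<Rightarrow> bool" where
  "tangent_to L C \<longleftrightarrow>
     (\<exists>(\<gamma> :: real \<Rightarrow> real \<times> real) v.
        range \<gamma> \<subseteq> C \<and> (\<gamma> has_vector_derivative v) (at 0) \<and> v \<noteq> 0 \<and>
        L = range (\<lambda>t. \<gamma> 0 + t *\<^sub>R v))"

end

theory Submission
  imports Defs
begin

text \<open>
  Rescale the two axes by \<open>sqrt a0\<close> and \<open>sqrt b0\<close>. The ellipse becomes the unit circle and the
  point with parameters \<open>s1\<close>, \<open>s2\<close> becomes
  \<open>(X, Y) = (sn s1 dn s2 / cn s2, cn s1 / cn s2)\<close>. The tangent to the circle at \<open>(sn w, cn w)\<close> is
  \<open>X sn w + Y cn w = 1\<close>, so this point lies on it if and only if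
  \<open>cn s1 cn w + sn s1 sn w dn s2 = cn s2\<close>. For \<open>s2 = w - s1\<close> and for \<open>s2 = s1 - w\<close> this is one and
  the same classical identity, \<open>cn_diff_with_dn\<close>:
  \<open>cn (u - v) = cn u cn v + sn u sn v dn (u - v)\<close>.
  Hence all the points with \<open>s1 + s2 = w\<close>, as well as those with \<open>s1 - s2 = w\<close>, lie on the tangent
  at \<open>(sn w, cn w)\<close>. The ellipse is confocal to the given family because \<open>a0 - b0 = a - b\<close>.

  The identity follows from the addition theorems for \<open>cn\<close> and \<open>dn\<close>. These hold because, along a
  curve \<open>u - v = const\<close>, their right-hand sides have derivative zero, while for \<open>v = 0\<close> they
  reduce to the left-hand sides. The derivatives of the elliptic functions come from that of the
  amplitude, the inverse of the integral \<open>ellF\<close>, whose integrand is at least \<open>1\<close>.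
\<close>

section \<open>The incomplete elliptic integral and the amplitude\<close>

definition ellDelta :: "real \<Rightarrow> real \<Rightarrow> real" where
  "ellDelta k \<theta> = sqrt (1 - k\<^sup>2 * (sin \<theta>)\<^sup>2)"

lemma one_minus_ksin_bounds:
  fixes k \<theta> :: real
  assumes "0 < k" "k < 1"
  shows "0 < 1 - k\<^sup>2 * (sin \<theta>)\<^sup>2" and "1 - k\<^sup>2 * (sin \<theta>)\<^sup>2 \<le> 1"
proof -
  have "k\<^sup>2 < 1" using assms by (simp add: power_less_one_iff)
  moreover have "k\<^sup>2 * (sin \<theta>)\<^sup>2 \<le> k\<^sup>2 * 1"
    by (intro mult_left_mono) (auto simp: sin_squared_eq)
  ultimately show "0 < 1 - k\<^sup>2 * (sin \<theta>)\<^sup>2" by linarith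
qed simp

lemma ellDelta_bounds:
  assumes "0 < k" "k < 1"
  shows "0 < ellDelta k \<theta>" and "ellDelta k \<theta> \<le> 1"
  using one_minus_ksin_bounds[OF assms, of \<theta>] by (auto simp: ellDelta_def)

lemma ellDelta_squared:
  assumes "0 < k" "k < 1"
  shows "(ellDelta k \<theta>)\<^sup>2 = 1 - k\<^sup>2 * (sin \<theta>)\<^sup>2"
  using one_minus_ksin_bounds(1)[OF assms, of \<theta>] by (simp add: ellDelta_def)

lemma continuous_on_inverse_ellDelta:
  assumes "0 < k" "k < 1"
  shows "continuous_on S (\<lambda>\<theta>. 1 / ellDelta k \<theta>)"
proof -
  have "ellDelta k \<theta> \<noteq> 0" for \<theta> using ellDelta_bounds(1)[OF assms, of \<theta>] by simp
  thus ?thesis unfolding ellDelta_def by (intro continuous_intros) auto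
qed

lemma ellF_has_real_derivative:
  assumes "0 < k" "k < 1"
  shows "((\<lambda>\<phi>. ellF \<phi> k) has_real_derivative 1 / ellDelta k \<phi>) (at \<phi>)"
proof -
  define r where "r = \<bar>\<phi>\<bar> + 1"
  have "((\<lambda>u. LBINT \<theta>=ereal 0..ereal u. 1 / ellDelta k \<theta>) has_vector_derivative
          1 / ellDelta k \<phi>) (at \<phi> within {-r..r})"
    using continuous_on_inverse_ellDelta[OF assms, of "{-r..r}"]
    by (intro interval_integral_FTC2) (auto simp: r_def)
  moreover have "at \<phi> within {-r..r} = at \<phi>"
    by (rule at_within_interior) (auto simp: r_def)
  ultimately show ?thesis
    by (simp add: ellF_def ellDelta_def has_real_derivative_iff_has_vector_derivative)
qed

lemma ellF_zero [simp]: "ellF 0 k = 0"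
  by (simp add: ellF_def)

lemma ellF_strict_mono:
  assumes "0 < k" "k < 1" and "\<phi> < \<psi>"
  shows "ellF \<phi> k < ellF \<psi> k"
proof (rule DERIV_pos_imp_increasing[OF \<open>\<phi> < \<psi>\<close>])
  fix x :: real
  show "\<exists>y. ((\<lambda>\<phi>. ellF \<phi> k) has_real_derivative y) (at x) \<and> 0 < y"
    using ellF_has_real_derivative[OF assms(1,2), of x] ellDelta_bounds(1)[OF assms(1,2), of x]
    by (intro exI[of _ "1 / ellDelta k x"]) auto
qed

lemma ellF_less_iff:
  assumes "0 < k" "k < 1"
  shows "ellF \<phi> k < ellF \<psi> k \<longleftrightarrow> \<phi> < \<psi>"
  using ellF_strict_mono[OF assms] by (metis less_asym linorder_neqE_linordered_idom)

text \<open>Since the integrand is at least \<open>1\<close>, the function \<open>ellF \<phi> k - \<phi>\<close> is nondecreasing. So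
  \<open>ellF\<close> is unbounded in both directions, and by continuity it takes every value.\<close>

lemma ellF_surj:
  assumes "0 < k" "k < 1"
  obtains \<phi> where "ellF \<phi> k = u"
proof -
  have mono: "ellF p k - p \<le> ellF q k - q" if "p \<le> q" for p q
  proof (rule DERIV_nonneg_imp_nondecreasing[OF that])
    fix x :: real
    have "((\<lambda>\<phi>. ellF \<phi> k - \<phi>) has_real_derivative 1 / ellDelta k x - 1) (at x)"
      by (rule derivative_eq_intros ellF_has_real_derivative[OF assms] refl)+
    moreover have "0 \<le> 1 / ellDelta k x - 1" using ellDelta_bounds[OF assms, of x] by simp
    ultimately show "\<exists>y. ((\<lambda>\<phi>. ellF \<phi> k - \<phi>) has_real_derivative y) (at x) \<and> 0 \<le> y" by blast
  qed
  have "ellF (- \<bar>u\<bar>) k \<le> u" "u \<le> ellF \<bar>u\<bar> k"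
    using mono[of "- \<bar>u\<bar>" 0] mono[of 0 "\<bar>u\<bar>"] by auto
  moreover have "isCont (\<lambda>\<phi>. ellF \<phi> k) x" for x
    using ellF_has_real_derivative[OF assms] by (rule DERIV_isCont)
  ultimately show ?thesis
    using IVT[of "\<lambda>\<phi>. ellF \<phi> k" "- \<bar>u\<bar>" u "\<bar>u\<bar>"] that by auto
qed

lemma jacobi_am_ellF:
  assumes "0 < k" "k < 1"
  shows "jacobi_am (ellF \<phi> k) k = \<phi>"
  unfolding jacobi_am_def
proof (rule the_equality)
  fix \<psi> assume "ellF \<psi> k = ellF \<phi> k"
  thus "\<psi> = \<phi>" using ellF_less_iff[OF assms] by (metis less_irrefl linorder_neqE_linordered_idom)
qed simp

lemma ellF_jacobi_am:
  assumes "0 < k" "k < 1"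
  shows "ellF (jacobi_am u k) k = u"
  using ellF_surj[OF assms, of u] jacobi_am_ellF[OF assms] by metis

lemma jacobi_am_zero:
  assumes "0 < k" "k < 1"
  shows "jacobi_am 0 k = 0"
  using jacobi_am_ellF[OF assms, of 0] by simp

lemma jacobi_dn_eq_ellDelta: "jacobi_dn u k = ellDelta k (jacobi_am u k)"
  by (simp add: jacobi_dn_def jacobi_sn_def ellDelta_def)

section \<open>Derivatives and quadratic relations of the Jacobi functions\<close>

lemma jacobi_am_has_real_derivative:
  assumes "0 < k" "k < 1"
  shows "((\<lambda>u. jacobi_am u k) has_real_derivative jacobi_dn u k) (at u)"
proof -
  have "isCont (\<lambda>u. jacobi_am u k) (ellF (jacobi_am u k) k)"
  proof (rule isCont_inverse_function[where d = 1 and f = "\<lambda>\<phi>. ellF \<phi> k"])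
    show "jacobi_am (ellF z k) k = z" for z by (rule jacobi_am_ellF[OF assms])
    show "isCont (\<lambda>\<phi>. ellF \<phi> k) z" for z
      using ellF_has_real_derivative[OF assms] by (rule DERIV_isCont)
  qed simp
  hence cont: "isCont (\<lambda>u. jacobi_am u k) u" by (simp add: ellF_jacobi_am[OF assms])
  have "((\<lambda>u. jacobi_am u k) has_real_derivative inverse (1 / jacobi_dn u k)) (at u)"
  proof (rule DERIV_inverse_function[where a = "u - 1" and b = "u + 1"])
    show "((\<lambda>\<phi>. ellF \<phi> k) has_real_derivative 1 / jacobi_dn u k) (at (jacobi_am u k))"
      using ellF_has_real_derivative[OF assms] by (simp add: jacobi_dn_eq_ellDelta)
    show "1 / jacobi_dn u k \<noteq> 0"
      using ellDelta_bounds(1)[OF assms, of "jacobi_am u k"] by (simp add: jacobi_dn_eq_ellDelta)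
  qed (use cont ellF_jacobi_am[OF assms] in auto)
  thus ?thesis by simp
qed

lemma jacobi_dn_pos:
  assumes "0 < k" "k < 1"
  shows "0 < jacobi_dn u k"
  using ellDelta_bounds(1)[OF assms] by (simp add: jacobi_dn_eq_ellDelta)

lemma jacobi_cn_squared: "(jacobi_cn u k)\<^sup>2 = 1 - (jacobi_sn u k)\<^sup>2"
  by (simp add: jacobi_cn_def jacobi_sn_def cos_squared_eq)

lemma jacobi_dn_squared:
  assumes "0 < k" "k < 1"
  shows "(jacobi_dn u k)\<^sup>2 = 1 - k\<^sup>2 * (jacobi_sn u k)\<^sup>2"
  using ellDelta_squared[OF assms] by (simp add: jacobi_dn_eq_ellDelta jacobi_sn_def)

lemma jacobi_sn_has_real_derivative:
  assumes "0 < k" "k < 1"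
  shows "((\<lambda>u. jacobi_sn u k) has_real_derivative jacobi_cn u k * jacobi_dn u k) (at u)"
  unfolding jacobi_sn_def jacobi_cn_def
  by (rule derivative_eq_intros jacobi_am_has_real_derivative[OF assms] refl)+

lemma jacobi_cn_has_real_derivative:
  assumes "0 < k" "k < 1"
  shows "((\<lambda>u. jacobi_cn u k) has_real_derivative - (jacobi_sn u k * jacobi_dn u k)) (at u)"
  unfolding jacobi_sn_def jacobi_cn_def
  by (rule derivative_eq_intros jacobi_am_has_real_derivative[OF assms] refl)+ simp

lemma jacobi_dn_has_real_derivative:
  assumes "0 < k" "k < 1"
  shows "((\<lambda>u. jacobi_dn u k) has_real_derivative - (k\<^sup>2 * jacobi_sn u k * jacobi_cn u k)) (at u)"
proof -
  have pos: "0 < 1 - k\<^sup>2 * (jacobi_sn u k)\<^sup>2"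
    using jacobi_dn_pos[OF assms, of u] by (simp add: jacobi_dn_def)
  have "((\<lambda>u. sqrt (1 - k\<^sup>2 * (jacobi_sn u k)\<^sup>2)) has_real_derivative
          inverse (sqrt (1 - k\<^sup>2 * (jacobi_sn u k)\<^sup>2)) / 2 *
          (- (k\<^sup>2 * (2 * jacobi_sn u k * (jacobi_cn u k * jacobi_dn u k))))) (at u)"
    using pos
    by - (rule derivative_eq_intros jacobi_sn_has_real_derivative[OF assms] refl | simp)+
  thus ?thesis
    using jacobi_dn_pos[OF assms, of u] by (simp add: jacobi_dn_def[symmetric] field_simps)
qed

lemma jacobi_cn_pos:
  assumes "0 < k" "k < 1" and "0 \<le> u" "u < ellK k"
  shows "0 < jacobi_cn u k"
proof -
  have "ellF (jacobi_am u k) k < ellF (pi / 2) k" "\<not> ellF (jacobi_am u k) k < ellF 0 k"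
    using assms by (simp_all add: ellF_jacobi_am ellK_def)
  hence "0 \<le> jacobi_am u k" "jacobi_am u k < pi / 2"
    unfolding ellF_less_iff[OF assms(1,2)] by auto
  thus ?thesis unfolding jacobi_cn_def by (intro cos_gt_zero_pi) auto
qed

section \<open>Addition theorems\<close>

lemma addition_denominator_pos:
  assumes "0 < k" "k < 1"
  shows "0 < 1 - k\<^sup>2 * (jacobi_sn u k)\<^sup>2 * (jacobi_sn v k)\<^sup>2"
proof -
  have "k\<^sup>2 * (jacobi_sn u k)\<^sup>2 * (jacobi_sn v k)\<^sup>2 \<le> k\<^sup>2 * (jacobi_sn u k)\<^sup>2 * 1"
    by (intro mult_left_mono) (auto simp: jacobi_sn_def abs_square_le_1)
  thus ?thesis
    using one_minus_ksin_bounds(1)[OF assms, of "jacobi_am u k"] by (simp add: jacobi_sn_def)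
qed

lemma quotient_constant:
  fixes N D N' D' :: "real \<Rightarrow> real"
  assumes N: "\<And>t. (N has_real_derivative N' t) (at t)"
    and D: "\<And>t. (D has_real_derivative D' t) (at t)"
    and D0: "\<And>t. D t \<noteq> 0" and eq: "\<And>t. N' t * D t = N t * D' t"
  shows "N u / D u = N v / D v"
proof (rule DERIV_isconst_all[of "\<lambda>t. N t / D t"], rule allI)
  fix t
  show "((\<lambda>t. N t / D t) has_real_derivative 0) (at t)"
    using DERIV_divide[OF N[of t] D[of t] D0[of t]] eq[of t] by simp
qed

text \<open>Both quotients below are constant along \<open>u = t + w\<close>, \<open>v = t\<close>: the numerator of the
  derivative is a polynomial in the six functions that vanishes modulo the relations
  \<open>cn\<^sup>2 = 1 - sn\<^sup>2\<close> and \<open>dn\<^sup>2 = 1 - k\<^sup>2 sn\<^sup>2\<close>. At \<open>t = 0\<close> they equal \<open>cn w\<close> and \<open>dn w\<close>.\<close>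

lemma
  assumes "0 < k" "k < 1"
  shows jacobi_cn_diff: "jacobi_cn (u - v) k =
      (jacobi_cn u k * jacobi_cn v k
         + jacobi_sn u k * jacobi_sn v k * jacobi_dn u k * jacobi_dn v k)
      / (1 - k\<^sup>2 * (jacobi_sn u k)\<^sup>2 * (jacobi_sn v k)\<^sup>2)"
    and jacobi_dn_diff: "jacobi_dn (u - v) k =
      (jacobi_dn u k * jacobi_dn v k
         + k\<^sup>2 * jacobi_sn u k * jacobi_sn v k * jacobi_cn u k * jacobi_cn v k)
      / (1 - k\<^sup>2 * (jacobi_sn u k)\<^sup>2 * (jacobi_sn v k)\<^sup>2)"
proof -
  define w where "w = u - v"
  define S C E s c d where "S t = jacobi_sn (t + w) k" and "C t = jacobi_cn (t + w) k"
    and "E t = jacobi_dn (t + w) k" and "s t = jacobi_sn t k" and "c t = jacobi_cn t k"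
    and "d t = jacobi_dn t k" for t
  note defs = this
  define D where "D t = 1 - k\<^sup>2 * (S t)\<^sup>2 * (s t)\<^sup>2" for t
  define D' where "D' t = - k\<^sup>2 * (2 * S t * (C t * E t) * (s t)\<^sup>2
    + (S t)\<^sup>2 * (2 * s t * (c t * d t)))" for t
  have rel: "(C t)\<^sup>2 = 1 - (S t)\<^sup>2" "(E t)\<^sup>2 = 1 - k\<^sup>2 * (S t)\<^sup>2"
    "(c t)\<^sup>2 = 1 - (s t)\<^sup>2" "(d t)\<^sup>2 = 1 - k\<^sup>2 * (s t)\<^sup>2" for t
    unfolding defs by (simp_all add: jacobi_cn_squared jacobi_dn_squared[OF assms])
  have deriv:
    "(S has_real_derivative C t * E t) (at t)" "(C has_real_derivative - (S t * E t)) (at t)"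
    "(E has_real_derivative - (k\<^sup>2 * S t * C t)) (at t)"
    "(s has_real_derivative c t * d t) (at t)" "(c has_real_derivative - (s t * d t)) (at t)"
    "(d has_real_derivative - (k\<^sup>2 * s t * c t)) (at t)" for t
    unfolding defs
    by (rule jacobi_sn_has_real_derivative[OF assms] jacobi_cn_has_real_derivative[OF assms]
        jacobi_dn_has_real_derivative[OF assms]
        jacobi_sn_has_real_derivative[OF assms, THEN iffD1[OF DERIV_shift]]
        jacobi_cn_has_real_derivative[OF assms, THEN iffD1[OF DERIV_shift]]
        jacobi_dn_has_real_derivative[OF assms, THEN iffD1[OF DERIV_shift]])+
  have derivD: "(D has_real_derivative D' t) (at t)" for t
    unfolding D_def D'_def
    by (rule derivative_eq_intros deriv refl)+ (simp add: algebra_simps)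
  have D0: "D t \<noteq> 0" for t
    using addition_denominator_pos[OF assms, of "t + w" t] by (simp add: D_def defs)
  have zero: "S 0 = jacobi_sn w k" "C 0 = jacobi_cn w k" "E 0 = jacobi_dn w k"
    "s 0 = 0" "c 0 = 1" "d 0 = 1"
    by (simp_all add: defs jacobi_sn_def jacobi_cn_def jacobi_dn_def jacobi_am_zero[OF assms])
  show "jacobi_cn (u - v) k =
      (jacobi_cn u k * jacobi_cn v k
         + jacobi_sn u k * jacobi_sn v k * jacobi_dn u k * jacobi_dn v k)
      / (1 - k\<^sup>2 * (jacobi_sn u k)\<^sup>2 * (jacobi_sn v k)\<^sup>2)"
  proof -
    define N where "N t = C t * c t + S t * s t * E t * d t" for t
    define N' where "N' t = - (S t * E t) * c t - C t * (s t * d t) + C t * E t * s t * E t * d t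
      + S t * (c t * d t) * E t * d t - S t * s t * (k\<^sup>2 * S t * C t) * d t
      - S t * s t * E t * (k\<^sup>2 * s t * c t)" for t
    have derivN: "(N has_real_derivative N' t) (at t)" for t
      unfolding N_def N'_def
      by (rule derivative_eq_intros deriv refl)+ (simp add: algebra_simps)
    have "N' t * D t = N t * D' t" for t
      using rel[of t] unfolding N_def N'_def D_def D'_def by algebra
    from quotient_constant[OF derivN derivD D0 this, of v 0] show ?thesis
      by (simp add: N_def D_def zero) (simp add: defs w_def)
  qed
  show "jacobi_dn (u - v) k =
      (jacobi_dn u k * jacobi_dn v k
         + k\<^sup>2 * jacobi_sn u k * jacobi_sn v k * jacobi_cn u k * jacobi_cn v k)
      / (1 - k\<^sup>2 * (jacobi_sn u k)\<^sup>2 * (jacobi_sn v k)\<^sup>2)"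
  proof -
    define N where "N t = E t * d t + k\<^sup>2 * S t * s t * C t * c t" for t
    define N' where "N' t = - (k\<^sup>2 * S t * C t) * d t - E t * (k\<^sup>2 * s t * c t)
      + k\<^sup>2 * (C t * E t * s t * C t * c t + S t * (c t * d t) * C t * c t
        - S t * s t * (S t * E t) * c t - S t * s t * C t * (s t * d t))" for t
    have derivN: "(N has_real_derivative N' t) (at t)" for t
      unfolding N_def N'_def
      by (rule derivative_eq_intros deriv refl)+ (simp add: algebra_simps)
    have "N' t * D t = N t * D' t" for t
      using rel[of t] unfolding N_def N'_def D_def D'_def by algebra
    from quotient_constant[OF derivN derivD D0 this, of v 0] show ?thesis
      by (simp add: N_def D_def zero) (simp add: defs w_def)
  qed
qed

text \<open>After substitution of the two addition theorems and multiplication by their common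
  denominator \<open>1 - k\<^sup>2 sn\<^sup>2 u sn\<^sup>2 v\<close>, the terms with \<open>k\<^sup>2\<close> cancel.\<close>

lemma cn_diff_with_dn:
  assumes "0 < k" "k < 1"
  shows "jacobi_cn (u - v) k =
    jacobi_cn u k * jacobi_cn v k + jacobi_sn u k * jacobi_sn v k * jacobi_dn (u - v) k"
proof -
  define D where "D = 1 - k\<^sup>2 * (jacobi_sn u k)\<^sup>2 * (jacobi_sn v k)\<^sup>2"
  have D0: "D \<noteq> 0" using addition_denominator_pos[OF assms, of u v] by (simp add: D_def)
  have "D * jacobi_cn (u - v) k = jacobi_cn u k * jacobi_cn v k
       + jacobi_sn u k * jacobi_sn v k * jacobi_dn u k * jacobi_dn v k"
    unfolding jacobi_cn_diff[OF assms] D_def[symmetric] using D0 by simp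
  moreover have "D * jacobi_dn (u - v) k = jacobi_dn u k * jacobi_dn v k
       + k\<^sup>2 * jacobi_sn u k * jacobi_sn v k * jacobi_cn u k * jacobi_cn v k"
    unfolding jacobi_dn_diff[OF assms] D_def[symmetric] using D0 by simp
  ultimately have "D * jacobi_cn (u - v) k = D * (jacobi_cn u k * jacobi_cn v k
      + jacobi_sn u k * jacobi_sn v k * jacobi_dn (u - v) k)"
    unfolding D_def by algebra
  thus ?thesis using D0 by simp
qed

section \<open>Tangent lines of an ellipse\<close>

lemma straight_line_range:
  fixes p v :: "real \<times> real"
  assumes "v \<noteq> 0"
  shows "straight_line (range (\<lambda>t. p + t *\<^sub>R v))"
proof -
  have "range (\<lambda>t. p + t *\<^sub>R v) = affine hull {p, p + v}"
    by (simp add: affine_hull_2_alt)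
  moreover have "aff_dim {p, p + v} = 1" using assms by (simp add: aff_dim_2)
  ultimately show ?thesis by (simp add: straight_line_def affine_affine_hull)
qed

text \<open>The path \<open>t \<mapsto> (A sin (\<theta> + t), B cos (\<theta> + t))\<close> runs in the ellipse. Measuring the angle
  from the second axis makes the point of contact \<open>(A sn w, B cn w)\<close> when \<open>\<theta>\<close> is the amplitude
  of \<open>w\<close>.\<close>

lemma ellipse_tangent_line:
  fixes A B \<theta> :: real
  assumes "A > 0" "B > 0"
  defines "L \<equiv> {(x, y). x / A * sin \<theta> + y / B * cos \<theta> = 1}"
  shows "straight_line L" and "tangent_to L (central_conic (A\<^sup>2) (B\<^sup>2))"
proof -
  define \<gamma> where "\<gamma> t = (A * sin (\<theta> + t), B * cos (\<theta> + t))" for t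
  define v where "v = (A * cos \<theta>, - (B * sin \<theta>))"
  have v0: "v \<noteq> 0" using assms sin_zero_abs_cos_one[of \<theta>] by (auto simp: v_def zero_prod_def)
  have pyth: "(sin \<theta>)\<^sup>2 + (cos \<theta>)\<^sup>2 = 1" by simp
  have L: "L = range (\<lambda>t. \<gamma> 0 + t *\<^sub>R v)"
  proof (intro equalityI subsetI)
    fix p assume "p \<in> L"
    then obtain x y where p: "p = (x, y)" "x / A * sin \<theta> + y / B * cos \<theta> = 1"
      by (auto simp: L_def)
    \<comment> \<open>In the scaled coordinates \<open>v\<close> is a unit vector, so \<open>t\<close> is the inner product with it.\<close>
    define X Y where "X = x / A" and "Y = y / B"
    define t where "t = X * cos \<theta> - Y * sin \<theta>"
    have xy: "x = A * X" "y = B * Y" using assms by (simp_all add: X_def Y_def)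
    have "X * sin \<theta> + Y * cos \<theta> = 1" using p by (simp add: X_def Y_def)
    hence "X = sin \<theta> + t * cos \<theta>" "Y = cos \<theta> - t * sin \<theta>"
      using pyth unfolding t_def by algebra+
    hence "p = (A * (sin \<theta> + t * cos \<theta>), B * (cos \<theta> - t * sin \<theta>))" by (simp only: p(1) xy)
    hence "p = \<gamma> 0 + t *\<^sub>R v" by (simp add: \<gamma>_def v_def algebra_simps)
    thus "p \<in> range (\<lambda>t. \<gamma> 0 + t *\<^sub>R v)" by blast
  next
    fix p assume "p \<in> range (\<lambda>t. \<gamma> 0 + t *\<^sub>R v)"
    then obtain t where "p = \<gamma> 0 + t *\<^sub>R v" by blast
    hence p: "p = (A * (sin \<theta> + t * cos \<theta>), B * (cos \<theta> - t * sin \<theta>))"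
      by (simp add: \<gamma>_def v_def algebra_simps)
    have "(sin \<theta> + t * cos \<theta>) * sin \<theta> + (cos \<theta> - t * sin \<theta>) * cos \<theta> = 1"
      using pyth by algebra
    thus "p \<in> L" using assms by (simp add: p L_def)
  qed
  show "straight_line L" unfolding L by (rule straight_line_range[OF v0])
  have "range \<gamma> \<subseteq> central_conic (A\<^sup>2) (B\<^sup>2)"
    using assms by (auto simp: \<gamma>_def central_conic_def power_mult_distrib)
  moreover have "(\<gamma> has_vector_derivative v) (at 0)"
    unfolding \<gamma>_def v_def
    by (intro has_vector_derivative_Pair)
      (auto simp flip: has_real_derivative_iff_has_vector_derivative intro!: derivative_eq_intros)
  ultimately show "tangent_to L (central_conic (A\<^sup>2) (B\<^sup>2))"
    unfolding tangent_to_def using v0 L by blast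
qed

theorem proposition8p1:
  fixes a b k k' a0 b0 :: real
    and f1 g1 f2 g2 :: "real \<Rightarrow> real"
    and x y :: "real \<Rightarrow> real \<Rightarrow> real"
  assumes "a > b" and "0 < k" and "k < 1" and "k' = sqrt (1 - k\<^sup>2)"
    and "\<And>s1. s1 \<in> {0..2 * ellK k} \<Longrightarrow> f1 s1 = sqrt (a - b) * jacobi_sn s1 k"
    and "\<And>s1. s1 \<in> {0..2 * ellK k} \<Longrightarrow> g1 s1 = sqrt (a - b) * jacobi_cn s1 k"
    and "\<And>s2. s2 \<in> {0..<ellK k} \<Longrightarrow>
           f2 s2 = sqrt (a - b) / k * (jacobi_dn s2 k / jacobi_cn s2 k)"
    and "\<And>s2. s2 \<in> {0..<ellK k} \<Longrightarrow>
           g2 s2 = k' * sqrt (a - b) / k * (1 / jacobi_cn s2 k)"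
    and "\<And>s1 s2. s1 \<in> {0..2 * ellK k} \<Longrightarrow> s2 \<in> {0..<ellK k} \<Longrightarrow>
           x s1 s2 = f1 s1 * f2 s2 / sqrt (a - b)"
    and "\<And>s1 s2. s1 \<in> {0..2 * ellK k} \<Longrightarrow> s2 \<in> {0..<ellK k} \<Longrightarrow>
           y s1 s2 = g1 s1 * g2 s2 / sqrt (a - b)"
    and "a0 = 1 / k\<^sup>2 * (a - b)" and "b0 = k'\<^sup>2 / k\<^sup>2 * (a - b)"
  shows "(\<forall>\<xi>. \<exists>L. straight_line L \<and>
            {(x s1 s2, y s1 s2) |s1 s2.
               s1 \<in> {0..2 * ellK k} \<and> s2 \<in> {0..<ellK k} \<and> s1 + s2 = \<xi>} \<subseteq> L \<and>
            tangent_to L (central_conic a0 b0)) \<and>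
         (\<forall>\<eta>. \<exists>L. straight_line L \<and>
            {(x s1 s2, y s1 s2) |s1 s2.
               s1 \<in> {0..2 * ellK k} \<and> s2 \<in> {0..<ellK k} \<and> s2 - s1 = \<eta>} \<subseteq> L \<and>
            tangent_to L (central_conic a0 b0)) \<and>
         central_conic a0 b0 \<in> confocal_family a b"
proof -
  note k = \<open>0 < k\<close> \<open>k < 1\<close>
  have k'sq: "k'\<^sup>2 = 1 - k\<^sup>2" and k'pos: "0 < k'"
    using k by (simp_all add: assms(4) power_le_one power_less_one_iff)
  define A B where "A = sqrt (a - b) / k" and "B = k' * sqrt (a - b) / k"
  have AB: "A > 0" "B > 0" using k k'pos \<open>a > b\<close> by (simp_all add: A_def B_def)
  have ab0: "a0 = A\<^sup>2" "b0 = B\<^sup>2"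
    using \<open>a > b\<close> by (simp_all add: assms(11,12) A_def B_def power_divide power_mult_distrib)
  define L where
    "L w = {(x, y). x / A * sin (jacobi_am w k) + y / B * cos (jacobi_am w k) = 1}" for w
  have line: "straight_line (L w)" "tangent_to (L w) (central_conic a0 b0)" for w
    unfolding L_def ab0 by (rule ellipse_tangent_line[OF AB])+
  have mem: "(x s1 s2, y s1 s2) \<in> L w"
    if s: "s1 \<in> {0..2 * ellK k}" "s2 \<in> {0..<ellK k}"
      and tangency: "jacobi_cn s2 k =
        jacobi_cn s1 k * jacobi_cn w k + jacobi_sn s1 k * jacobi_sn w k * jacobi_dn s2 k"
    for s1 s2 w
  proof -
    have cn: "0 < jacobi_cn s2 k" using jacobi_cn_pos[OF k] s(2) by simp
    have "x s1 s2 = A * (jacobi_sn s1 k * jacobi_dn s2 k / jacobi_cn s2 k)"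
      "y s1 s2 = B * (jacobi_cn s1 k / jacobi_cn s2 k)"
      using \<open>a > b\<close>
      by (simp_all add: assms(9,10)[OF s] assms(5,6)[OF s(1)] assms(7,8)[OF s(2)] A_def B_def)
    hence scaled: "x s1 s2 / A = jacobi_sn s1 k * jacobi_dn s2 k / jacobi_cn s2 k"
      "y s1 s2 / B = jacobi_cn s1 k / jacobi_cn s2 k"
      using AB by simp_all
    have "x s1 s2 / A * jacobi_sn w k + y s1 s2 / B * jacobi_cn w k
      = (jacobi_cn s1 k * jacobi_cn w k + jacobi_sn s1 k * jacobi_sn w k * jacobi_dn s2 k)
        / jacobi_cn s2 k"
      unfolding scaled by (simp add: add_divide_distrib mult_ac)
    also have "\<dots> = 1" using cn unfolding tangency[symmetric] by simp
    finally show ?thesis by (simp add: L_def jacobi_sn_def jacobi_cn_def)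
  qed
  have sum: "(x s1 s2, y s1 s2) \<in> L (s1 + s2)"
    if "s1 \<in> {0..2 * ellK k}" "s2 \<in> {0..<ellK k}" for s1 s2
    using cn_diff_with_dn[OF k, of "s1 + s2" s1] by (intro mem that) (simp add: mult_ac)
  have diff: "(x s1 s2, y s1 s2) \<in> L (- (s2 - s1))"
    if "s1 \<in> {0..2 * ellK k}" "s2 \<in> {0..<ellK k}" for s1 s2
    using cn_diff_with_dn[OF k, of s1 "- (s2 - s1)"] by (intro mem that) simp
  have confocal: "central_conic a0 b0 \<in> confocal_family a b"
  proof -
    have "a + (a0 - a) = a0" "b + (a0 - a) = b0"
      using k by (simp_all add: assms(11,12) k'sq field_simps)
    moreover have "a0 \<noteq> 0" "b0 \<noteq> 0" using AB by (simp_all add: ab0)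
    ultimately show ?thesis
      unfolding confocal_family_def by (intro CollectI exI[of _ "a0 - a"]) simp
  qed
  have "\<exists>L. straight_line L \<and>
            {(x s1 s2, y s1 s2) |s1 s2.
               s1 \<in> {0..2 * ellK k} \<and> s2 \<in> {0..<ellK k} \<and> s1 + s2 = \<xi>} \<subseteq> L \<and>
            tangent_to L (central_conic a0 b0)" for \<xi>
    using line[of \<xi>] sum by (intro exI[of _ "L \<xi>"]) blast
  moreover have "\<exists>L. straight_line L \<and>
            {(x s1 s2, y s1 s2) |s1 s2.
               s1 \<in> {0..2 * ellK k} \<and> s2 \<in> {0..<ellK k} \<and> s2 - s1 = \<eta>} \<subseteq> L \<and>
            tangent_to L (central_conic a0 b0)" for \<eta>
    using line[of "- \<eta>"] diff by (intro exI[of _ "L (- \<eta>)"]) blast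
  ultimately show ?thesis using confocal by blast
qed

end
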